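(* Let $(\mathbf{u},\rho)$ (with pressure $P$) be any classical solution of the stationary Boussinesq system $$(\mathbf{u}\cdot\nabla)\mathbf{u}=\nu\Delta\mathbf{u}-\frac{1}{\rho^*}\nabla P-\frac{\rho}{\rho^*}\nabla f,\qquad (\mathbf{u}\cdot\nabla)\rho=0,\qquad \nabla\cdot\mathbf{u}=0\qquad\text{in }\Omega,$$ subject to the boundary conditions $$\mathbf{u}\cdot\mathbf{n}=0\ \text{ on } x^2+y^2=a^2,\qquad \mathbf{u}\cdot\mathbf{n}=\nabla\times\mathbf{u}=0\ \text{ on } x^2+y^2=b^2,$$ $$\Big[\Big(-\frac{P}{\rho^*}\mathbf{I}+\nu\big(\nabla\mathbf{u}+(\nabla\mathbf{u})^{T}\big)\Big)\mathbf{n}\Big]\cdot\boldsymbol{\tau}+\alpha\,\mathbf{u}\cdot\boldsymbol{\tau}=0\ \text{ on } x^2+y^2=a^2.$$ If $\nu a^{-1}+\alpha\ge 0$ on $\{x^2+y^2=a^2\}$, then $$\mathbf{u}=0,\qquad \rho=\rho_s(x,y),$$ where $\rho_s$ solves $$\partial_y\rho_s\,\partial_x f-\partial_x\rho_s\,\partial_y f=0\quad\text{in }\Omega.$$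
   Context: Let $0<a<b$ and $\Omega=\{(x,y)\in\mathbb{R}^2: a^2<x^2+y^2<b^2\}$. $\mathbf{n}$ is the outward unit normal to $\partial\Omega$ and $\boldsymbol{\tau}$ a unit tangent vector. $\nu>0$ and $\rho^*>0$ are constants, $\alpha$ is a given real function on $\{x^2+y^2=a^2\}$, and $f$ is a given (sufficiently smooth) gravitational potential on $\overline\Omega$. $\mathbf{u}=(u_1,u_2)$ is the velocity, $\rho$ the scalar density, $P$ the scalar pressure, and $\nabla\times\mathbf{u}=\partial_x u_2-\partial_y u_1$. *)

theory Defs
  imports "HOL-Analysis.Analysis"
begin

definition annulus :: "real \<Rightarrow> real \<Rightarrow> (real^2) set" where
  "annulus a b = {z. a\<^sup>2 < (z$1)\<^sup>2 + (z$2)\<^sup>2 \<and> (z$1)\<^sup>2 + (z$2)\<^sup>2 < b\<^sup>2}"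

definition circle :: "real \<Rightarrow> (real^2) set" where
  "circle r = {z. (z$1)\<^sup>2 + (z$2)\<^sup>2 = r\<^sup>2}"

(* Partial derivative of g in the i-th coordinate direction, relative to S.
   For open S and z in S it is the ordinary partial derivative (at_within_open).
   For S the closed annulus and z on its boundary, the derivative within S is still
   uniquely determined (S has an interior cone at each of its points); when g is C^1
   on S in the sense below, it is the continuous extension of the interior partial
   derivative. *)
definition partial :: "(real^2) set \<Rightarrow> 2 \<Rightarrow> (real^2 \<Rightarrow> real) \<Rightarrow> real^2 \<Rightarrow> real" where
  "partial S i g z = frechet_derivative g (at z within S) (axis i 1)"

(* Used with S open and with S the closed annulus, where it means C^1 up to the boundary. *)
definition C1_on :: "(real^2) set \<Rightarrow> (real^2 \<Rightarrow> real) \<Rightarrow> bool" where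
  "C1_on S g \<longleftrightarrow> g differentiable_on S \<and> (\<forall>i. continuous_on S (partial S i g))"

definition C2_on :: "(real^2) set \<Rightarrow> (real^2 \<Rightarrow> real) \<Rightarrow> bool" where
  "C2_on S g \<longleftrightarrow> C1_on S g \<and> (\<forall>i. C1_on S (partial S i g))"

definition grad :: "(real^2) set \<Rightarrow> (real^2 \<Rightarrow> real) \<Rightarrow> real^2 \<Rightarrow> real^2" where
  "grad S g z = (\<chi> i. partial S i g z)"

(* Row i, column j: the j-th partial derivative of the i-th component. *)
definition vgrad :: "(real^2) set \<Rightarrow> (real^2 \<Rightarrow> real^2) \<Rightarrow> real^2 \<Rightarrow> real^2^2" where
  "vgrad S u z = (\<chi> i j. partial S j (\<lambda>w. u w $ i) z)"

definition divergence :: "(real^2) set \<Rightarrow> (real^2 \<Rightarrow> real^2) \<Rightarrow> real^2 \<Rightarrow> real" where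
  "divergence S u z = (\<Sum>i\<in>UNIV. partial S i (\<lambda>w. u w $ i) z)"

definition curl2 :: "(real^2) set \<Rightarrow> (real^2 \<Rightarrow> real^2) \<Rightarrow> real^2 \<Rightarrow> real" where
  "curl2 S u z = partial S 1 (\<lambda>w. u w $ 2) z - partial S 2 (\<lambda>w. u w $ 1) z"

definition laplacian :: "(real^2) set \<Rightarrow> (real^2 \<Rightarrow> real) \<Rightarrow> real^2 \<Rightarrow> real" where
  "laplacian S g z = (\<Sum>i\<in>UNIV. partial S i (partial S i g) z)"

definition vlaplacian :: "(real^2) set \<Rightarrow> (real^2 \<Rightarrow> real^2) \<Rightarrow> real^2 \<Rightarrow> real^2" where
  "vlaplacian S u z = (\<chi> i. laplacian S (\<lambda>w. u w $ i) z)"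

(* (u . nabla) u *)
definition convective :: "(real^2) set \<Rightarrow> (real^2 \<Rightarrow> real^2) \<Rightarrow> real^2 \<Rightarrow> real^2" where
  "convective S u z = (\<chi> i. u z \<bullet> grad S (\<lambda>w. u w $ i) z)"

(* Outward with respect to the annulus, hence pointing towards the origin on the inner circle. *)
definition outward_normal :: "real \<Rightarrow> real \<Rightarrow> real^2 \<Rightarrow> real^2" where
  "outward_normal a b z = (if z \<in> circle a then - ((1 / a) *\<^sub>R z) else (1 / b) *\<^sub>R z)"

definition unit_tangent_field ::
  "real \<Rightarrow> real \<Rightarrow> (real^2 \<Rightarrow> real^2) \<Rightarrow> bool" where
  "unit_tangent_field a b \<tau> \<longleftrightarrow>
     (\<forall>z \<in> circle a \<union> circle b. norm (\<tau> z) = 1 \<and> \<tau> z \<bullet> outward_normal a b z = 0)"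

(* Cauchy stress divided by the reference density rs; note that mat c is c times the identity. *)
definition stress ::
  "(real^2) set \<Rightarrow> real \<Rightarrow> real \<Rightarrow> (real^2 \<Rightarrow> real^2) \<Rightarrow> (real^2 \<Rightarrow> real) \<Rightarrow> real^2 \<Rightarrow> real^2^2" where
  "stress S \<nu> rs u P z = mat (- (P z / rs)) + \<nu> *\<^sub>R (vgrad S u z + transpose (vgrad S u z))"

(* Regularity of a classical solution: each field is as smooth in the open annulus as the
   equations require, and as smooth up to the boundary as the boundary conditions require. *)
definition classical_regularity ::
  "real \<Rightarrow> real \<Rightarrow> (real^2 \<Rightarrow> real^2) \<Rightarrow> (real^2 \<Rightarrow> real) \<Rightarrow> (real^2 \<Rightarrow> real) \<Rightarrow> bool" where
  "classical_regularity a b u \<rho> P \<longleftrightarrow>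
     (\<forall>i. C2_on (annulus a b) (\<lambda>z. u z $ i) \<and> C1_on (closure (annulus a b)) (\<lambda>z. u z $ i)) \<and>
     C1_on (annulus a b) \<rho> \<and> continuous_on (closure (annulus a b)) \<rho> \<and>
     C1_on (annulus a b) P \<and> continuous_on (closure (annulus a b)) P"

definition stationary_boussinesq ::
  "(real^2) set \<Rightarrow> real \<Rightarrow> real \<Rightarrow> (real^2 \<Rightarrow> real) \<Rightarrow>
   (real^2 \<Rightarrow> real^2) \<Rightarrow> (real^2 \<Rightarrow> real) \<Rightarrow> (real^2 \<Rightarrow> real) \<Rightarrow> bool" where
  "stationary_boussinesq S \<nu> rs f u \<rho> P \<longleftrightarrow>
     (\<forall>z\<in>S.
        convective S u z =
          \<nu> *\<^sub>R vlaplacian S u z - (1 / rs) *\<^sub>R grad S P z - (\<rho> z / rs) *\<^sub>R grad S f z \<and>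
        u z \<bullet> grad S \<rho> z = 0 \<and>
        divergence S u z = 0)"

definition boundary_conditions ::
  "real \<Rightarrow> real \<Rightarrow> real \<Rightarrow> real \<Rightarrow> (real^2 \<Rightarrow> real) \<Rightarrow> (real^2 \<Rightarrow> real^2) \<Rightarrow>
   (real^2 \<Rightarrow> real^2) \<Rightarrow> (real^2 \<Rightarrow> real) \<Rightarrow> bool" where
  "boundary_conditions a b \<nu> rs \<alpha> \<tau> u P \<longleftrightarrow>
     (\<forall>z \<in> circle a. u z \<bullet> outward_normal a b z = 0) \<and>
     (\<forall>z \<in> circle b. u z \<bullet> outward_normal a b z = 0 \<and> curl2 (closure (annulus a b)) u z = 0) \<and>
     (\<forall>z \<in> circle a.
        (stress (closure (annulus a b)) \<nu> rs u P z *v outward_normal a b z) \<bullet> \<tau> z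
          + \<alpha> z * (u z \<bullet> \<tau> z) = 0)"

definition hydrostatic_density ::
  "(real^2) set \<Rightarrow> (real^2 \<Rightarrow> real) \<Rightarrow> (real^2 \<Rightarrow> real) \<Rightarrow> bool" where
  "hydrostatic_density S f \<rho>s \<longleftrightarrow> C1_on S \<rho>s \<and>
     (\<forall>z\<in>S. partial S 2 \<rho>s z * partial S 1 f z - partial S 1 \<rho>s z * partial S 2 f z = 0)"

end

theory Submission
  imports Defs
begin

text \<open>
The proof is an energy estimate. Consider the vector field
\[ F = \nu \sum_i u_i \nabla u_i - \Bigl(\tfrac12 |u|^2 + \frac{P + \rho f}{\rho^*}\Bigr) u . \]
Multiplying the momentum equation by \<open>u\<close>, and using that \<open>u\<close> is divergence free and that \<open>\<rho>\<close> is
constant along \<open>u\<close> (so that the work \<open>\<rho> u \<bullet> \<nabla>f\<close> of gravity is the divergence of \<open>\<rho> f u\<close>), gives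
\<open>div F = \<nu> |\<nabla>u|\<^sup>2 \<ge> 0\<close>; this is \<open>divergence_energy_flux\<close>.

On both circles \<open>u\<close> is tangent, say \<open>u = w e\<^sub>\<theta>\<close>, so only the viscous part of \<open>F\<close> has a radial
component, namely \<open>\<nu> w (e\<^sub>\<theta> \<bullet> \<partial>\<^sub>r u)\<close>. Differentiating the condition \<open>u \<bullet> e\<^sub>r = 0\<close> along the circle of
radius \<open>r\<close> shows \<open>e\<^sub>r \<bullet> (\<nabla>u) e\<^sub>\<theta> = - w / r\<close>, a pure curvature term. On the outer circle the vorticity
\<open>e\<^sub>\<theta> \<bullet> (\<nabla>u) e\<^sub>r - e\<^sub>r \<bullet> (\<nabla>u) e\<^sub>\<theta>\<close> vanishes and the radial component is \<open>- \<nu> w\<^sup>2 / b \<le> 0\<close>. On the inner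
circle the slip condition prescribes the sum of the same two terms instead of their difference, and the
radial component is \<open>(\<nu> / a + \<alpha>) w\<^sup>2 \<ge> 0\<close>. So \<open>F\<close> flows out of the annulus through neither circle,
although it has no sinks inside: hence \<open>div F = 0\<close>, the gradient of \<open>u\<close> vanishes, and \<open>u\<close> is a constant
vector tangent to a circle at each of its points, that is, zero.

The divergence theorem enters in a form that only integrates over circles
(\<open>flux_has_derivative\<close>): the flux of \<open>F\<close> through the circle of radius \<open>r\<close> has as its derivative in
\<open>r\<close> the integral of \<open>div F\<close> over that circle. This matches the regularity of a classical solution, as
\<open>F\<close> is differentiable in the open annulus but merely continuous up to its boundary.

Once \<open>u = 0\<close>, the momentum equation reads \<open>\<nabla>P = - \<rho> \<nabla>f\<close>. The field \<open>\<rho> \<nabla>f\<close> is therefore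
curl free, and by symmetry of second derivatives its curl is the Jacobian of \<open>\<rho>\<close> and \<open>f\<close>, which is
what the hydrostatic equation asserts to be zero. Thus \<open>\<rho>\<close> itself serves as \<open>\<rho>\<^sub>s\<close>.
\<close>

section \<open>Calculus with partial derivatives\<close>

text \<open>
All partial derivatives at \<open>z\<close> are read off from one and the same chosen derivative within \<open>S\<close>, so
they assemble to it even when \<open>z\<close> lies on the boundary of \<open>S\<close>.
\<close>

lemma has_derivative_grad:
  assumes "g differentiable (at z within S)"
  shows "(g has_derivative (\<lambda>v. grad S g z \<bullet> v)) (at z within S)"
proof -
  let ?D = "frechet_derivative g (at z within S)"
  have D: "(g has_derivative ?D) (at z within S)"
    using assms frechet_derivative_works by blast
  then have lin: "linear ?D"
    by (rule has_derivative_linear)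
  have "?D v = grad S g z \<bullet> v" for v
  proof -
    have "?D v = ?D (\<Sum>i\<in>UNIV. v $ i *\<^sub>R axis i 1)"
      using basis_expansion[of v] by (simp add: scalar_mult_eq_scaleR)
    also have "\<dots> = (\<Sum>i\<in>UNIV. v $ i * partial S i g z)"
      using lin by (simp add: linear_sum linear_cmul partial_def)
    finally show ?thesis
      by (simp add: grad_def inner_vec_def mult.commute)
  qed
  with D show ?thesis
    by (metis (no_types, lifting) ext)
qed

text \<open>
The chain rule is applied to rays that run through the open annulus as well as to the boundary circles,
hence the derivative of \<open>g\<close> within \<open>S\<close> and the condition that the curve stays in \<open>S\<close>.
\<close>

lemma has_real_derivative_along_curve:
  assumes "g differentiable (at (\<gamma> t) within S)"
    and "(\<gamma> has_vector_derivative v) (at t within T)"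
    and "\<gamma> ` T \<subseteq> S"
  shows "((\<lambda>t. g (\<gamma> t)) has_real_derivative grad S g (\<gamma> t) \<bullet> v) (at t within T)"
proof -
  have "(g has_derivative (\<lambda>w. grad S g (\<gamma> t) \<bullet> w)) (at (\<gamma> t) within \<gamma> ` T)"
    using has_derivative_grad[OF assms(1)] assms(3) has_derivative_subset by blast
  from vector_derivative_diff_chain_within[OF assms(2) this]
  show ?thesis
    by (simp add: has_real_derivative_iff_has_vector_derivative o_def)
qed

lemma partial_eqI:
  assumes "open S" "z \<in> S" "(g has_derivative D) (at z)"
  shows "partial S i g z = D (axis i 1)"
  unfolding partial_def at_within_open[OF assms(2,1)]
  by (simp add: frechet_derivative_at[OF assms(3), symmetric])

lemma partial_cong:
  assumes "open S" "z \<in> S" "g differentiable (at z)" "\<And>w. w \<in> S \<Longrightarrow> g w = h w"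
  shows "partial S i h z = partial S i g z"
  unfolding partial_def at_within_open[OF assms(2,1)]
  by (simp add: frechet_derivative_transform_within_open[OF assms(3,1,2,4)])

text \<open>
The boundary conditions use derivatives within the closed annulus and the equations use derivatives
within the open one; this is the bridge between the two.
\<close>

lemma partial_subset:
  assumes "open S" "S \<subseteq> T" "z \<in> S"
  shows "partial T i g z = partial S i g z"
proof -
  have "z \<in> interior T"
    using interior_maximal[OF assms(2,1)] assms(3) by blast
  then show ?thesis
    unfolding partial_def at_within_open[OF assms(3,1)] by (simp only: at_within_interior)
qed

lemma C1_on_differentiable:
  assumes "C1_on S g" "z \<in> S"
  shows "g differentiable (at z within S)"
  using assms by (auto simp: C1_on_def differentiable_on_def)

lemma C1_on_has_derivative:
  assumes "C1_on S g" "open S" "z \<in> S"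
  shows "(g has_derivative (\<lambda>v. grad S g z \<bullet> v)) (at z)"
  using has_derivative_grad[OF C1_on_differentiable[OF assms(1,3)]]
  unfolding at_within_open[OF assms(3,2)] .

lemma C1_on_continuous: "C1_on S g \<Longrightarrow> continuous_on S g"
  by (simp add: C1_on_def differentiable_imp_continuous_on)

lemma C1_on_partial_continuous: "C1_on S g \<Longrightarrow> continuous_on S (partial S i g)"
  by (simp add: C1_on_def)

lemma C1_on_grad_continuous: "C1_on S g \<Longrightarrow> continuous_on S (grad S g)"
  unfolding grad_def by (intro continuous_on_vec_lambda C1_on_partial_continuous)

lemma C1_onI:
  assumes "open S"
    and "\<And>z. z \<in> S \<Longrightarrow> (g has_derivative D z) (at z)"
    and "\<And>i. continuous_on S (\<lambda>z. D z (axis i 1))"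
  shows "C1_on S g"
  unfolding C1_on_def
proof (intro conjI allI)
  show "g differentiable_on S"
    using assms(2) by (meson differentiableI differentiable_at_withinI differentiable_on_def)
  show "continuous_on S (partial S i g)" for i
    using assms(3)[of i] partial_eqI[OF assms(1) _ assms(2)]
    by (metis (no_types, lifting) continuous_on_cong)
qed

lemma C1_on_cong:
  assumes "open S" "C1_on S g" "\<And>w. w \<in> S \<Longrightarrow> g w = h w"
  shows "C1_on S h"
proof (rule C1_onI[OF assms(1)])
  show "(h has_derivative (\<lambda>v. grad S g z \<bullet> v)) (at z)" if "z \<in> S" for z
    by (rule has_derivative_transform_within_open[OF C1_on_has_derivative[OF assms(2,1) that]
          assms(1) that assms(3)])
  show "continuous_on S (\<lambda>z. grad S g z \<bullet> axis i 1)" for i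
    using assms(2) by (simp add: inner_axis grad_def C1_on_def)
qed

lemma grad_axis: "grad S g z \<bullet> axis i 1 = partial S i g z"
  by (simp add: inner_axis grad_def)

lemma
  assumes "open S" "C1_on S g" "C1_on S h"
  shows C1_on_add: "C1_on S (\<lambda>z. g z + h z)"
    and partial_add: "z \<in> S \<Longrightarrow> partial S i (\<lambda>z. g z + h z) z = partial S i g z + partial S i h z"
    and C1_on_diff: "C1_on S (\<lambda>z. g z - h z)"
    and partial_diff: "z \<in> S \<Longrightarrow> partial S i (\<lambda>z. g z - h z) z = partial S i g z - partial S i h z"
    and C1_on_mult: "C1_on S (\<lambda>z. g z * h z)"
    and partial_mult: "z \<in> S \<Longrightarrow>
      partial S i (\<lambda>z. g z * h z) z = g z * partial S i h z + partial S i g z * h z"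
proof -
  note D = C1_on_has_derivative[OF assms(2,1)] C1_on_has_derivative[OF assms(3,1)]
  note cont = assms(2,3)[THEN C1_on_continuous] assms(2,3)[THEN C1_on_grad_continuous]
  have add: "((\<lambda>z. g z + h z) has_derivative (\<lambda>v. grad S g z \<bullet> v + grad S h z \<bullet> v)) (at z)"
    and diff: "((\<lambda>z. g z - h z) has_derivative (\<lambda>v. grad S g z \<bullet> v - grad S h z \<bullet> v)) (at z)"
    and mult: "((\<lambda>z. g z * h z) has_derivative
      (\<lambda>v. g z * (grad S h z \<bullet> v) + (grad S g z \<bullet> v) * h z)) (at z)" if "z \<in> S" for z
    using D[OF that] by (auto intro: has_derivative_add has_derivative_diff has_derivative_mult)
  show "C1_on S (\<lambda>z. g z + h z)" "C1_on S (\<lambda>z. g z - h z)" "C1_on S (\<lambda>z. g z * h z)"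
    using cont
    by (auto intro!: C1_onI[OF assms(1) add] C1_onI[OF assms(1) diff] C1_onI[OF assms(1) mult]
        continuous_intros)
  assume z: "z \<in> S"
  show "partial S i (\<lambda>z. g z + h z) z = partial S i g z + partial S i h z"
    "partial S i (\<lambda>z. g z - h z) z = partial S i g z - partial S i h z"
    "partial S i (\<lambda>z. g z * h z) z = g z * partial S i h z + partial S i g z * h z"
    using partial_eqI[OF assms(1) z add[OF z]] partial_eqI[OF assms(1) z diff[OF z]]
      partial_eqI[OF assms(1) z mult[OF z]] by (auto simp: grad_axis)
qed

lemma
  assumes "open S"
  shows C1_on_const: "C1_on S (\<lambda>z. c)"
    and partial_const: "z \<in> S \<Longrightarrow> partial S i (\<lambda>z. c) z = 0"
  using C1_onI[OF assms, of "\<lambda>z. c" "\<lambda>z v. 0"] partial_eqI[OF assms, of z "\<lambda>z. c" "\<lambda>v. 0"]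
  by auto

section \<open>Symmetry of second derivatives\<close>

lemma has_real_derivative_along_axis:
  assumes "C1_on S g" "open S" "w + s *\<^sub>R axis i 1 \<in> S"
  shows "((\<lambda>s. g (w + s *\<^sub>R axis i 1)) has_real_derivative partial S i g (w + s *\<^sub>R axis i 1)) (at s)"
proof -
  have "((\<lambda>s. w + s *\<^sub>R axis i 1) has_derivative (\<lambda>h. h *\<^sub>R axis i 1)) (at s)"
    by (auto intro!: derivative_eq_intros)
  from diff_chain_at[OF this C1_on_has_derivative[OF assms]]
  show ?thesis
    by (simp add: has_field_derivative_def o_def grad_axis mult.commute[of _ "partial S i g _"]
        flip: inner_axis)
qed

text \<open>
The mean value theorem, first in direction \<open>i\<close> and then in direction \<open>j\<close>. The left-hand side is
symmetric in \<open>i\<close> and \<open>j\<close>, which is the whole reason for the symmetry of second derivatives.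
\<close>

lemma second_difference_eq_mixed_partial:
  assumes "C2_on S g" "open S" "0 < h"
    and "\<And>s t. s \<in> {0..h} \<Longrightarrow> t \<in> {0..h} \<Longrightarrow> z + s *\<^sub>R axis i 1 + t *\<^sub>R axis j 1 \<in> S"
  shows "\<exists>s\<in>{0<..<h}. \<exists>t\<in>{0<..<h}.
    g (z + h *\<^sub>R axis i 1 + h *\<^sub>R axis j 1) - g (z + h *\<^sub>R axis i 1) - g (z + h *\<^sub>R axis j 1) + g z
      = h\<^sup>2 * partial S j (partial S i g) (z + s *\<^sub>R axis i 1 + t *\<^sub>R axis j 1)"
proof -
  have C1: "C1_on S g" "C1_on S (partial S i g)"
    using assms(1) by (auto simp: C2_on_def)
  have comm: "z + s *\<^sub>R axis i 1 + t *\<^sub>R axis j 1 = (z + t *\<^sub>R axis j 1) + s *\<^sub>R axis i 1" for s t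
    by simp
  let ?\<phi> = "\<lambda>s. g (z + h *\<^sub>R axis j 1 + s *\<^sub>R axis i 1) - g (z + 0 *\<^sub>R axis j 1 + s *\<^sub>R axis i 1)"
  let ?\<phi>' = "\<lambda>s. partial S i g (z + h *\<^sub>R axis j 1 + s *\<^sub>R axis i 1)
    - partial S i g (z + 0 *\<^sub>R axis j 1 + s *\<^sub>R axis i 1)"
  have "(?\<phi> has_real_derivative ?\<phi>' s) (at s)" if "0 \<le> s" "s \<le> h" for s
    using assms(3) assms(4)[of s h] assms(4)[of s 0] that unfolding comm
    by (intro DERIV_diff has_real_derivative_along_axis[OF C1(1) assms(2)]) auto
  from MVT2[OF assms(3) this] obtain s where s: "0 < s" "s < h" "?\<phi> h - ?\<phi> 0 = h * ?\<phi>' s"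
    by auto
  let ?\<psi> = "\<lambda>t. partial S i g (z + s *\<^sub>R axis i 1 + t *\<^sub>R axis j 1)"
  have "(?\<psi> has_real_derivative partial S j (partial S i g) (z + s *\<^sub>R axis i 1 + t *\<^sub>R axis j 1)) (at t)"
    if "0 \<le> t" "t \<le> h" for t
    using assms(4)[of s t] that s by (intro has_real_derivative_along_axis[OF C1(2) assms(2)]) auto
  from MVT2[OF assms(3) this] obtain t where t: "0 < t" "t < h"
    "?\<psi> h - ?\<psi> 0 = h * partial S j (partial S i g) (z + s *\<^sub>R axis i 1 + t *\<^sub>R axis j 1)"
    by auto
  have "?\<phi>' s = ?\<psi> h - ?\<psi> 0"
    by (simp add: algebra_simps)
  with s(3) t(3) have "?\<phi> h - ?\<phi> 0
      = h\<^sup>2 * partial S j (partial S i g) (z + s *\<^sub>R axis i 1 + t *\<^sub>R axis j 1)"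
    by (simp add: power2_eq_square)
  then show ?thesis
    using s t by (intro bexI[of _ s] bexI[of _ t]) (auto simp: algebra_simps)
qed

text \<open>
If the two mixed derivatives differed at \<open>z\<close>, continuity would keep them apart on a small ball around
\<open>z\<close>; but \<open>second_difference_eq_mixed_partial\<close>, used in both orders on a small square, finds two points
of that ball, one for each derivative, at which they take the same value.
\<close>

lemma mixed_partials_commute:
  assumes "C2_on S g" "open S" "z \<in> S"
  shows "partial S j (partial S i g) z = partial S i (partial S j g) z"
proof (rule ccontr)
  let ?A = "partial S j (partial S i g)" and ?B = "partial S i (partial S j g)"
  assume "?A z \<noteq> ?B z"
  define \<epsilon> where "\<epsilon> = dist (?A z) (?B z) / 2"
  have "0 < \<epsilon>"
    using \<open>?A z \<noteq> ?B z\<close> by (simp add: \<epsilon>_def)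
  have "continuous_on S ?A" "continuous_on S ?B"
    using assms(1) by (auto simp: C2_on_def C1_on_def)
  then have "isCont ?A z" "isCont ?B z"
    using assms(2,3) continuous_on_eq_continuous_at by auto
  then obtain d1 d2 where d: "0 < d1" "\<And>w. dist w z < d1 \<Longrightarrow> dist (?A w) (?A z) < \<epsilon>"
    "0 < d2" "\<And>w. dist w z < d2 \<Longrightarrow> dist (?B w) (?B z) < \<epsilon>"
    using \<open>0 < \<epsilon>\<close> unfolding continuous_at_eps_delta by metis
  obtain d3 where d3: "0 < d3" "ball z d3 \<subseteq> S"
    using assms(2,3) openE by blast
  \<comment> \<open>A point of the square of side \<open>h\<close> is at distance at most \<open>2 * h\<close> from its corner \<open>z\<close>; the
    factor 3 makes the bound strict.\<close>
  define h where "h = min d1 (min d2 d3) / 3"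
  have h: "0 < h" "3 * h \<le> d1" "3 * h \<le> d2" "3 * h \<le> d3"
    using d d3 by (auto simp: h_def)
  have near: "dist (z + s *\<^sub>R axis k 1 + t *\<^sub>R axis l 1) z < 3 * h"
    if "s \<in> {0..h}" "t \<in> {0..h}" for s t and k l :: 2
  proof -
    have "norm (s *\<^sub>R axis k (1::real) + t *\<^sub>R axis l 1) \<le> s + t"
      using that norm_triangle_ineq[of "s *\<^sub>R axis k (1::real)" "t *\<^sub>R axis l 1"]
      by (simp add: norm_axis_1)
    then show ?thesis
      using that h(1) by (simp add: dist_norm add.assoc)
  qed
  have inS: "z + s *\<^sub>R axis k 1 + t *\<^sub>R axis l 1 \<in> S"
    if "s \<in> {0..h}" "t \<in> {0..h}" for s t and k l :: 2
  proof -
    have "z + s *\<^sub>R axis k 1 + t *\<^sub>R axis l 1 \<in> ball z d3"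
      using near[OF that, of k l] h(4) by (simp add: dist_commute)
    then show ?thesis
      using d3(2) by blast
  qed
  obtain s t where st: "s \<in> {0<..<h}" "t \<in> {0<..<h}"
    "g (z + h *\<^sub>R axis i 1 + h *\<^sub>R axis j 1) - g (z + h *\<^sub>R axis i 1) - g (z + h *\<^sub>R axis j 1) + g z
      = h\<^sup>2 * ?A (z + s *\<^sub>R axis i 1 + t *\<^sub>R axis j 1)"
    using second_difference_eq_mixed_partial[OF assms(1,2) h(1) inS] by blast
  obtain s' t' where st': "s' \<in> {0<..<h}" "t' \<in> {0<..<h}"
    "g (z + h *\<^sub>R axis j 1 + h *\<^sub>R axis i 1) - g (z + h *\<^sub>R axis j 1) - g (z + h *\<^sub>R axis i 1) + g z
      = h\<^sup>2 * ?B (z + s' *\<^sub>R axis j 1 + t' *\<^sub>R axis i 1)"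
    using second_difference_eq_mixed_partial[OF assms(1,2) h(1) inS] by blast
  have "h\<^sup>2 * ?A (z + s *\<^sub>R axis i 1 + t *\<^sub>R axis j 1) = h\<^sup>2 * ?B (z + s' *\<^sub>R axis j 1 + t' *\<^sub>R axis i 1)"
    using st(3) st'(3) by (simp add: algebra_simps)
  then have "?A (z + s *\<^sub>R axis i 1 + t *\<^sub>R axis j 1) = ?B (z + s' *\<^sub>R axis j 1 + t' *\<^sub>R axis i 1)"
    using h(1) by simp
  moreover have "dist (?A (z + s *\<^sub>R axis i 1 + t *\<^sub>R axis j 1)) (?A z) < \<epsilon>"
    using near[of s t i j] st h(2) by (intro d(2)) auto
  moreover have "dist (?B (z + s' *\<^sub>R axis j 1 + t' *\<^sub>R axis i 1)) (?B z) < \<epsilon>"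
    using near[of s' t' j i] st' h(3) by (intro d(4)) auto
  ultimately have "dist (?A z) (?B z) < dist (?A z) (?B z)"
    unfolding \<epsilon>_def by (metis dist_triangle_half_r)
  then show False
    by simp
qed

section \<open>Polar coordinates and flux\<close>

definition radial :: "real \<Rightarrow> real^2" where
  "radial \<theta> = cos \<theta> *\<^sub>R axis 1 1 + sin \<theta> *\<^sub>R axis 2 1"

definition angular :: "real \<Rightarrow> real^2" where
  "angular \<theta> = - sin \<theta> *\<^sub>R axis 1 1 + cos \<theta> *\<^sub>R axis 2 1"

lemma radial_nth [simp]: "radial \<theta> $ 1 = cos \<theta>" "radial \<theta> $ 2 = sin \<theta>"
  and angular_nth [simp]: "angular \<theta> $ 1 = - sin \<theta>" "angular \<theta> $ 2 = cos \<theta>"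
  by (auto simp: radial_def angular_def axis_def)

lemma inner_2: "x \<bullet> y = x $ 1 * y $ 1 + x $ 2 * y $ 2" for x y :: "real^2"
  by (simp add: inner_vec_def sum_2)

lemma power2_norm_2: "(norm x)\<^sup>2 = (x $ 1)\<^sup>2 + (x $ 2)\<^sup>2" for x :: "real^2"
  unfolding power2_norm_eq_inner inner_2 by (simp add: power2_eq_square)

lemma has_vector_derivative_radial: "(radial has_vector_derivative angular \<theta>) (at \<theta> within T)"
  unfolding radial_def angular_def by (auto intro!: derivative_eq_intros)

lemma continuous_on_radial [continuous_intros]:
  "continuous_on T g \<Longrightarrow> continuous_on T (\<lambda>x. radial (g x))" for T :: "'a::t2_space set"
  unfolding radial_def by (intro continuous_intros)

lemma open_annulus: "open (annulus a b)"
  unfolding annulus_def Collect_conj_eq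
  by (intro open_Int open_Collect_less continuous_intros)

lemma polar_sq: "(r * cos \<theta>)\<^sup>2 + (r * sin \<theta>)\<^sup>2 = (r::real)\<^sup>2"
  by (simp add: power_mult_distrib flip: distrib_left)

lemma polar_in_circle: "r *\<^sub>R radial \<theta> \<in> circle r"
  by (simp add: circle_def polar_sq)

lemma polar_in_annulus:
  assumes "0 \<le> a" "a < r" "r < b"
  shows "r *\<^sub>R radial \<theta> \<in> annulus a b"
  using assms by (simp add: annulus_def polar_sq power_strict_mono)

lemma annulus_polar:
  assumes "z \<in> annulus a b" "0 \<le> a" "0 \<le> b"
  obtains r \<theta> where "a < r" "r < b" "\<theta> \<in> {0..2 * pi}" "z = r *\<^sub>R radial \<theta>"
proof -
  define r where "r = norm z"
  have r2: "r\<^sup>2 = (z$1)\<^sup>2 + (z$2)\<^sup>2"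
    by (simp add: r_def power2_norm_2)
  then have "a < r" "r < b"
    using assms power_less_imp_less_base[of a 2 r] power_less_imp_less_base[of r 2 b]
    by (auto simp: annulus_def r_def)
  have "(z$1 / r)\<^sup>2 + (z$2 / r)\<^sup>2 = 1"
    unfolding power_divide add_divide_distrib[symmetric] r2[symmetric] using \<open>a < r\<close> assms(2) by simp
  then obtain t where t: "0 \<le> t" "t < 2 * pi" "z$1 / r = cos t" "z$2 / r = sin t"
    using sincos_total_2pi by metis
  then have "z = r *\<^sub>R radial t"
    using \<open>a < r\<close> assms by (auto simp: vec_eq_iff forall_2 field_simps)
  then show ?thesis
    by (rule that[OF \<open>a < r\<close> \<open>r < b\<close>, rotated]) (use t in simp)
qed

text \<open>
A boundary point is the limit of the points on its ray.
\<close>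

lemma polar_in_closure_annulus:
  assumes "0 \<le> a" "a < b" "r \<in> {a..b}"
  shows "r *\<^sub>R radial \<theta> \<in> closure (annulus a b)"
proof -
  have "(\<lambda>r. r *\<^sub>R radial \<theta>) ` closure {a<..<b} \<subseteq> closure (annulus a b)"
    using assms by (intro image_closure_subset closed_closure)
      (auto intro!: continuous_intros intro!: subsetD[OF closure_subset] polar_in_annulus)
  moreover have "r \<in> closure {a<..<b}"
    using assms by simp
  ultimately show ?thesis
    by blast
qed

lemma connected_annulus_2:
  assumes "0 \<le> a" "0 \<le> b"
  shows "connected (annulus a b)"
proof -
  have sq_less_iff: "x\<^sup>2 < y\<^sup>2 \<longleftrightarrow> x < y" if "0 \<le> x" "0 \<le> y" for x y :: real
    using that power2_less_imp_less[of x y] power_strict_mono[of x y 2] by auto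
  have "annulus a b = {z. a < norm (z - 0) \<and> norm (z - 0) < b}"
    unfolding annulus_def power2_norm_2[symmetric] using assms by (simp add: sq_less_iff)
  then show ?thesis
    using connected_annulus(1)[of a "0::real^2" b] by simp
qed

definition flux :: "(real^2 \<Rightarrow> real^2) \<Rightarrow> real \<Rightarrow> real" where
  "flux F r = integral {0..2 * pi} (\<lambda>\<theta>. r * (F (r *\<^sub>R radial \<theta>) \<bullet> radial \<theta>))"

lemma continuous_on_flux:
  assumes "0 \<le> a" "a < b" "continuous_on (closure (annulus a b)) F"
  shows "continuous_on {a..b} (flux F)"
proof -
  have "continuous_on ({a..b} \<times> {0..2 * pi}) (\<lambda>x. F (fst x *\<^sub>R radial (snd x)))"
    using assms by (intro continuous_on_compose2[OF assms(3)])
      (auto intro!: continuous_intros polar_in_closure_annulus)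
  then have "continuous_on ({a..b} \<times> {0..2 * pi})
      (\<lambda>(r, \<theta>). r * (F (r *\<^sub>R radial \<theta>) \<bullet> radial \<theta>))"
    unfolding case_prod_unfold by (intro continuous_intros)
  then have "continuous_on {a..b}
      (\<lambda>r. integral (cbox 0 (2 * pi)) (\<lambda>\<theta>. r * (F (r *\<^sub>R radial \<theta>) \<bullet> radial \<theta>)))"
    by (intro integral_continuous_on_param) (simp only: box_real)
  then show ?thesis
    by (simp only: flux_def[abs_def] box_real)
qed

text \<open>
In polar coordinates \<open>r div F = \<partial>\<^sub>r (r F\<^sub>r) + \<partial>\<^sub>\<theta> F\<^sub>\<theta>\<close>. Differentiating under the integral sign gives
the integral of the first summand (\<open>\<phi>\<close> in the proof), and the second one (\<open>\<psi>\<close>) integrates to zero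
because \<open>F\<^sub>\<theta>\<close> is periodic.
\<close>

lemma flux_has_derivative:
  assumes "0 \<le> a" "\<And>i. C1_on (annulus a b) (\<lambda>z. F z $ i)" "a < r" "r < b"
  shows "(flux F has_real_derivative
    integral {0..2 * pi} (\<lambda>\<theta>. r * divergence (annulus a b) F (r *\<^sub>R radial \<theta>))) (at r)"
proof -
  let ?S = "annulus a b"
  let ?g = "\<lambda>i. grad ?S (\<lambda>z. F z $ i)"
  define \<phi> where "\<phi> r \<theta> = F (r *\<^sub>R radial \<theta>) \<bullet> radial \<theta> +
    r * ((?g 1 (r *\<^sub>R radial \<theta>) \<bullet> radial \<theta>) * cos \<theta> + (?g 2 (r *\<^sub>R radial \<theta>) \<bullet> radial \<theta>) * sin \<theta>)"
    for r \<theta>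
  define \<psi> where "\<psi> \<theta> = (?g 1 (r *\<^sub>R radial \<theta>) \<bullet> (r *\<^sub>R angular \<theta>)) * - sin \<theta>
    + (?g 2 (r *\<^sub>R radial \<theta>) \<bullet> (r *\<^sub>R angular \<theta>)) * cos \<theta> - F (r *\<^sub>R radial \<theta>) \<bullet> radial \<theta>" for \<theta>
  have contF: "continuous_on ?S F"
    using continuous_on_vec_lambda[of ?S "\<lambda>i z. F z $ i"] C1_on_continuous[OF assms(2)] by simp
  have contg: "continuous_on ?S (?g i)" for i
    by (intro C1_on_grad_continuous assms(2))
  have radial_deriv: "((\<lambda>r. F (r *\<^sub>R radial \<theta>) $ i) has_real_derivative ?g i (s *\<^sub>R radial \<theta>) \<bullet> radial \<theta>)
      (at s within {a<..<b})" if "s \<in> {a<..<b}" for i s \<theta>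
    using that assms(1) by (intro has_real_derivative_along_curve[where g="\<lambda>z. F z $ i"]
        C1_on_differentiable[OF assms(2)])
      (auto intro!: derivative_eq_intros polar_in_annulus)
  have angular_deriv: "((\<lambda>\<theta>. F (r *\<^sub>R radial \<theta>) $ i) has_real_derivative
      ?g i (r *\<^sub>R radial \<theta>) \<bullet> (r *\<^sub>R angular \<theta>)) (at \<theta> within {0..2 * pi})" for i \<theta>
    using assms(1,3,4) by (intro has_real_derivative_along_curve[where g="\<lambda>z. F z $ i"]
        C1_on_differentiable[OF assms(2)])
      (auto intro!: derivative_eq_intros polar_in_annulus has_vector_derivative_radial)
  have Fpol: "continuous_on ({a<..<b} \<times> {0..2 * pi}) (\<lambda>x. F (fst x *\<^sub>R radial (snd x)))"
    using assms by (intro continuous_on_compose2[OF contF])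
      (auto intro!: continuous_intros polar_in_annulus)
  have gpol: "continuous_on ({a<..<b} \<times> {0..2 * pi}) (\<lambda>x. ?g i (fst x *\<^sub>R radial (snd x)))" for i
    using assms by (intro continuous_on_compose2[OF contg])
      (auto intro!: continuous_intros polar_in_annulus)
  have Fr: "continuous_on {0..2 * pi} (\<lambda>\<theta>. F (s *\<^sub>R radial \<theta>))" if "s \<in> {a<..<b}" for s
    using assms that by (intro continuous_on_compose2[OF contF])
      (auto intro!: continuous_intros polar_in_annulus)
  have gr: "continuous_on {0..2 * pi} (\<lambda>\<theta>. ?g i (r *\<^sub>R radial \<theta>))" for i
    using assms by (intro continuous_on_compose2[OF contg])
      (auto intro!: continuous_intros polar_in_annulus)
  have "((\<lambda>r. integral (cbox 0 (2 * pi)) (\<lambda>\<theta>. r * (F (r *\<^sub>R radial \<theta>) \<bullet> radial \<theta>)))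
      has_real_derivative integral (cbox 0 (2 * pi)) (\<phi> r)) (at r within {a<..<b})"
  proof (rule leibniz_rule_field_derivative)
    show "((\<lambda>r. r * (F (r *\<^sub>R radial \<theta>) \<bullet> radial \<theta>)) has_real_derivative \<phi> s \<theta>) (at s within {a<..<b})"
      if "s \<in> {a<..<b}" for s \<theta>
      unfolding inner_2[of "F _"] \<phi>_def
      by (auto intro!: derivative_eq_intros radial_deriv[OF that] simp: algebra_simps)
    show "(\<lambda>\<theta>. s * (F (s *\<^sub>R radial \<theta>) \<bullet> radial \<theta>)) integrable_on cbox 0 (2 * pi)"
      if "s \<in> {a<..<b}" for s
      using Fr[OF that] by (auto intro!: integrable_continuous_real continuous_intros)
    show "continuous_on ({a<..<b} \<times> cbox 0 (2 * pi)) (\<lambda>(x, t). \<phi> x t)"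
      unfolding \<phi>_def case_prod_unfold using Fpol gpol by (auto intro!: continuous_intros)
  qed (use assms in auto)
  then have main: "(flux F has_real_derivative integral {0..2 * pi} (\<phi> r)) (at r)"
    using assms by (simp add: flux_def[abs_def] at_within_open[of r "{a<..<b}"])
  have "((\<lambda>\<theta>. F (r *\<^sub>R radial \<theta>) \<bullet> angular \<theta>) has_real_derivative \<psi> \<theta>) (at \<theta> within {0..2 * pi})" for \<theta>
    unfolding inner_2[of "F _"] \<psi>_def angular_nth
    by (rule derivative_eq_intros angular_deriv refl)+ (simp add: algebra_simps)
  then have "(\<psi> has_integral F (r *\<^sub>R radial (2 * pi)) \<bullet> angular (2 * pi) - F (r *\<^sub>R radial 0) \<bullet> angular 0)
      {0..2 * pi}"
    by (intro fundamental_theorem_of_calculus)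
      (auto simp: has_real_derivative_iff_has_vector_derivative)
  moreover have "radial (2 * pi) = radial 0" "angular (2 * pi) = angular 0"
    by (simp_all add: radial_def angular_def)
  ultimately have \<psi>: "(\<psi> has_integral 0) {0..2 * pi}"
    by simp
  have "\<phi> r integrable_on {0..2 * pi}"
    unfolding \<phi>_def using Fr[of r] gr assms
    by (auto intro!: integrable_continuous_real continuous_intros)
  from has_integral_add[OF integrable_integral[OF this] \<psi>]
  have "integral {0..2 * pi} (\<lambda>\<theta>. \<phi> r \<theta> + \<psi> \<theta>) = integral {0..2 * pi} (\<phi> r)"
    by (simp add: integral_unique)
  moreover have "\<phi> r \<theta> + \<psi> \<theta> = r * divergence ?S F (r *\<^sub>R radial \<theta>)" for \<theta>
  proof -
    let ?d = "?g 1 (r *\<^sub>R radial \<theta>) $ 1 + ?g 2 (r *\<^sub>R radial \<theta>) $ 2"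
    have "\<phi> r \<theta> + \<psi> \<theta> = cos \<theta> * cos \<theta> * (r * ?d) + sin \<theta> * sin \<theta> * (r * ?d)"
      unfolding \<phi>_def \<psi>_def by (simp add: inner_2 algebra_simps)
    also have "\<dots> = r * ?d"
      by (simp flip: distrib_right)
    finally show ?thesis
      by (simp add: divergence_def sum_2 grad_def)
  qed
  ultimately show ?thesis
    using main by simp
qed


lemma continuous_on_polar:
  assumes "0 \<le> a" "a < r" "r < b" "continuous_on (annulus a b) h"
  shows "continuous_on T (\<lambda>\<theta>. h (r *\<^sub>R radial \<theta>))"
  using assms(1-3) by (intro continuous_on_compose2[OF assms(4)])
    (auto intro!: continuous_intros polar_in_annulus)

lemma flux_nonneg:
  assumes "0 \<le> r" "\<And>\<theta>. 0 \<le> F (r *\<^sub>R radial \<theta>) \<bullet> radial \<theta>"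
  shows "0 \<le> flux F r"
proof (cases "(\<lambda>\<theta>. r * (F (r *\<^sub>R radial \<theta>) \<bullet> radial \<theta>)) integrable_on {0..2 * pi}")
  case True
  then show ?thesis
    unfolding flux_def using assms by (intro integral_nonneg) auto
next
  \<comment> \<open>The integral of a function that is not integrable is \<open>0\<close> by convention.\<close>
  case False
  then show ?thesis
    by (simp only: flux_def not_integrable_integral[OF False] order_refl)
qed

lemma flux_nonpos:
  assumes "0 \<le> r" "\<And>\<theta>. F (r *\<^sub>R radial \<theta>) \<bullet> radial \<theta> \<le> 0"
  shows "flux F r \<le> 0"
proof -
  have "flux (\<lambda>z. - F z) r = - flux F r"
    by (simp add: flux_def)
  then show ?thesis
    using flux_nonneg[of r "\<lambda>z. - F z"] assms by simp
qed

text \<open>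
The flux through the circle of radius \<open>r\<close> is nondecreasing in \<open>r\<close>, starts at a nonnegative value and
ends at a nonpositive one. So it is constantly zero, and its derivative, the integral of a continuous
nonnegative function over a circle, is zero too. The walls themselves are reached by continuity of the
flux in \<open>r\<close>.
\<close>

lemma divergence_eq_0_if_no_outflow:
  fixes F :: "real^2 \<Rightarrow> real^2"
  assumes "0 \<le> a" "a < b"
    and cont: "continuous_on (closure (annulus a b)) F"
    and C1: "\<And>i. C1_on (annulus a b) (\<lambda>z. F z $ i)"
    and cont_div: "continuous_on (annulus a b) (divergence (annulus a b) F)"
    and nonneg: "\<And>z. z \<in> annulus a b \<Longrightarrow> 0 \<le> divergence (annulus a b) F z"
    and inner: "\<And>\<theta>. 0 \<le> F (a *\<^sub>R radial \<theta>) \<bullet> radial \<theta>"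
    and outer: "\<And>\<theta>. F (b *\<^sub>R radial \<theta>) \<bullet> radial \<theta> \<le> 0"
    and "z \<in> annulus a b"
  shows "divergence (annulus a b) F z = 0"
proof -
  let ?I = "\<lambda>r. integral {0..2 * pi} (\<lambda>\<theta>. r * divergence (annulus a b) F (r *\<^sub>R radial \<theta>))"
  have deriv: "(flux F has_real_derivative ?I r) (at r)" if "a < r" "r < b" for r
    using flux_has_derivative[OF assms(1) C1 that] .
  have contI: "continuous_on {0..2 * pi} (\<lambda>\<theta>. r * divergence (annulus a b) F (r *\<^sub>R radial \<theta>))"
    if "a < r" "r < b" for r
    by (intro continuous_intros continuous_on_polar[OF assms(1) that cont_div])
  have pos: "0 \<le> r * divergence (annulus a b) F (r *\<^sub>R radial \<theta>)" if "a < r" "r < b" for r \<theta>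
    using that assms(1) by (intro mult_nonneg_nonneg nonneg polar_in_annulus) auto
  have I_nonneg: "0 \<le> ?I r" if "a < r" "r < b" for r
    using pos[OF that] contI[OF that] by (intro integral_nonneg integrable_continuous_real)
  have mono: "flux F r \<le> flux F s" if "a \<le> r" "r \<le> s" "s \<le> b" for r s
  proof (rule DERIV_nonneg_imp_increasing_open[OF that(2)])
    show "\<exists>y. (flux F has_real_derivative y) (at x) \<and> 0 \<le> y" if "r < x" "x < s" for x
      using deriv[of x] I_nonneg[of x] \<open>a \<le> r\<close> \<open>s \<le> b\<close> that
      by (intro exI[of _ "?I x"]) simp
    show "continuous_on {r..s} (flux F)"
      using that by (intro continuous_on_subset[OF continuous_on_flux[OF assms(1,2) cont]]) auto
  qed
  have "flux F b \<le> 0" "0 \<le> flux F a"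
    using assms(1,2) by (auto intro: flux_nonpos[OF _ outer] flux_nonneg[OF _ inner])
  then have zero: "flux F r = 0" if "a < r" "r < b" for r
    using mono[of a r] mono[of r b] that by auto
  obtain r \<theta> where r: "a < r" "r < b" "\<theta> \<in> {0..2 * pi}" "z = r *\<^sub>R radial \<theta>"
    using annulus_polar[OF assms(9,1)] assms(1,2) by (metis less_eq_real_def order_trans)
  have "(flux F has_real_derivative 0) (at r)"
    by (rule has_field_derivative_transform_within_open[OF DERIV_const[of 0]
          open_greaterThanLessThan[of a b]]) (use r(1,2) zero in simp_all)
  then have "?I r = 0"
    using DERIV_unique[OF deriv[OF r(1,2)]] by simp
  moreover have "(?I r = 0) = (\<forall>\<theta>\<in>{0..2 * pi}. r * divergence (annulus a b) F (r *\<^sub>R radial \<theta>) = 0)"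
    by (rule integral_eq_0_iff[OF contI[OF r(1,2)] _ pos[OF r(1,2)]]) simp
  ultimately have "r * divergence (annulus a b) F (r *\<^sub>R radial \<theta>) = 0"
    using r(3) by blast
  then show ?thesis
    using r assms(1) by simp
qed

section \<open>The energy balance\<close>

text \<open>
The viscous part \<open>\<nu> \<nabla>(|u|\<^sup>2 / 2)\<close> minus the transport by \<open>u\<close> of the Bernoulli function, in which the
potential energy is \<open>\<rho> f\<close>. Constant factors are written as multiplications so that the rules for sums,
differences and products suffice to differentiate the field.
\<close>

definition energy_flux ::
  "(real^2) set \<Rightarrow> real \<Rightarrow> real \<Rightarrow> (real^2 \<Rightarrow> real) \<Rightarrow> (real^2 \<Rightarrow> real^2) \<Rightarrow> (real^2 \<Rightarrow> real) \<Rightarrow>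
   (real^2 \<Rightarrow> real) \<Rightarrow> real^2 \<Rightarrow> real^2" where
  "energy_flux S \<nu> rs f u \<rho> P z = (\<chi> j.
     \<nu> * (u z $ 1 * partial S j (\<lambda>w. u w $ 1) z + u z $ 2 * partial S j (\<lambda>w. u w $ 2) z)
     - ((1 / 2) * (u z $ 1 * u z $ 1 + u z $ 2 * u z $ 2) + (1 / rs) * (P z + \<rho> z * f z)) * u z $ j)"

lemma continuous_on_energy_flux:
  assumes "\<And>i. C1_on S (\<lambda>z. u z $ i)" "continuous_on S f" "continuous_on S \<rho>" "continuous_on S P"
  shows "continuous_on S (energy_flux S \<nu> rs f u \<rho> P)"
proof -
  note C1_on_continuous[OF assms(1)] C1_on_partial_continuous[OF assms(1)]
  then show ?thesis
    unfolding energy_flux_def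
    by (intro continuous_on_vec_lambda continuous_on_add continuous_on_diff continuous_on_mult
        continuous_on_const assms(2-4))
qed

text \<open>
The terms of the divergence are grouped into multiples of the continuity equation, of the transport
equation for the density and of the two components of the momentum equation; all of these vanish, and
the squares of the first derivatives remain.
\<close>

lemma
  assumes "open S" "\<And>i. C2_on S (\<lambda>z. u z $ i)" "C1_on S f" "C1_on S \<rho>" "C1_on S P"
  shows C1_on_energy_flux: "C1_on S (\<lambda>z. energy_flux S \<nu> rs f u \<rho> P z $ j)"
    and divergence_energy_flux: "stationary_boussinesq S \<nu> rs f u \<rho> P \<Longrightarrow> z \<in> S \<Longrightarrow>
      divergence S (energy_flux S \<nu> rs f u \<rho> P) z
        = \<nu> * (\<Sum>i\<in>UNIV. \<Sum>j\<in>UNIV. (partial S j (\<lambda>w. u w $ i) z)\<^sup>2)"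
proof -
  have C1: "C1_on S (\<lambda>z. u z $ i)" "C1_on S (partial S j (\<lambda>z. u z $ i))" for i j
    using assms(2) by (auto simp: C2_on_def)
  note rules = C1_on_add C1_on_diff C1_on_mult C1_on_const
  show "C1_on S (\<lambda>z. energy_flux S \<nu> rs f u \<rho> P z $ j)"
    unfolding energy_flux_def vec_lambda_beta by (intro rules assms C1)
  assume eqs: "stationary_boussinesq S \<nu> rs f u \<rho> P" and z: "z \<in> S"
  let ?d = "\<lambda>j i. partial S j (\<lambda>w. u w $ i) z"
  let ?q = "(1 / 2) * (u z $ 1 * u z $ 1 + u z $ 2 * u z $ 2) + (1 / rs) * (P z + \<rho> z * f z)"
  have mom: "u z $ 1 * ?d 1 i + u z $ 2 * ?d 2 i
      = \<nu> * (partial S 1 (partial S 1 (\<lambda>w. u w $ i)) z + partial S 2 (partial S 2 (\<lambda>w. u w $ i)) z)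
        - (1 / rs) * partial S i P z - (1 / rs) * \<rho> z * partial S i f z" for i
  proof -
    have "convective S u z $ i = (\<nu> *\<^sub>R vlaplacian S u z - (1 / rs) *\<^sub>R grad S P z
        - (\<rho> z / rs) *\<^sub>R grad S f z) $ i"
      using eqs z by (simp add: stationary_boussinesq_def)
    then show ?thesis
      by (simp add: convective_def vlaplacian_def laplacian_def grad_def inner_2 sum_2)
  qed
  have transport: "u z $ 1 * partial S 1 \<rho> z + u z $ 2 * partial S 2 \<rho> z = 0"
    using eqs z by (simp add: stationary_boussinesq_def grad_def inner_2)
  have incompressible: "?d 1 1 + ?d 2 2 = 0"
    using eqs z by (simp add: stationary_boussinesq_def divergence_def sum_2)
  have flux_partial: "partial S j (\<lambda>z. energy_flux S \<nu> rs f u \<rho> P z $ j) z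
      = \<nu> * (u z $ 1 * partial S j (partial S j (\<lambda>w. u w $ 1)) z + ?d j 1 * ?d j 1
           + (u z $ 2 * partial S j (partial S j (\<lambda>w. u w $ 2)) z + ?d j 2 * ?d j 2))
        - (?q * ?d j j + ((1 / 2) * (u z $ 1 * ?d j 1 + ?d j 1 * u z $ 1 + (u z $ 2 * ?d j 2 + ?d j 2 * u z $ 2))
          + (1 / rs) * (partial S j P z + (\<rho> z * partial S j f z + partial S j \<rho> z * f z))) * u z $ j)" for j
    unfolding energy_flux_def vec_lambda_beta
    by (simp only: partial_add[OF assms(1)] partial_diff[OF assms(1)] partial_mult[OF assms(1)]
        partial_const[OF assms(1)] rules[OF assms(1)] assms C1 z mult_zero_left mult_zero_right add_0_right add_0_left)
  have "divergence S (energy_flux S \<nu> rs f u \<rho> P) z =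
      \<nu> * (\<Sum>i\<in>UNIV. \<Sum>j\<in>UNIV. (?d j i)\<^sup>2) - ?q * (?d 1 1 + ?d 2 2)
      - (1 / rs) * f z * (u z $ 1 * partial S 1 \<rho> z + u z $ 2 * partial S 2 \<rho> z)
      + u z $ 1 * (\<nu> * (partial S 1 (partial S 1 (\<lambda>w. u w $ 1)) z + partial S 2 (partial S 2 (\<lambda>w. u w $ 1)) z)
        - (1 / rs) * partial S 1 P z - (1 / rs) * \<rho> z * partial S 1 f z - (u z $ 1 * ?d 1 1 + u z $ 2 * ?d 2 1))
      + u z $ 2 * (\<nu> * (partial S 1 (partial S 1 (\<lambda>w. u w $ 2)) z + partial S 2 (partial S 2 (\<lambda>w. u w $ 2)) z)
        - (1 / rs) * partial S 2 P z - (1 / rs) * \<rho> z * partial S 2 f z - (u z $ 1 * ?d 1 2 + u z $ 2 * ?d 2 2))"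
    unfolding divergence_def sum_2 flux_partial by (simp add: algebra_simps power2_eq_square)
  then show "divergence S (energy_flux S \<nu> rs f u \<rho> P) z
      = \<nu> * (\<Sum>i\<in>UNIV. \<Sum>j\<in>UNIV. (?d j i)\<^sup>2)"
    unfolding mom transport incompressible by simp
qed

section \<open>Boundary terms\<close>

text \<open>
The derivative of the identity \<open>u \<bullet> e\<^sub>r = 0\<close> along the circle; the right-hand side comes from the turning
of \<open>e\<^sub>r\<close>. This is how the curvature \<open>1 / r\<close> of the wall enters the boundary terms.
\<close>

lemma tangential_derivative_of_normal_component:
  assumes "\<And>i. C1_on S (\<lambda>z. u z $ i)" "\<And>\<theta>. r *\<^sub>R radial \<theta> \<in> S"
    and tangent: "\<And>\<theta>. u (r *\<^sub>R radial \<theta>) \<bullet> radial \<theta> = 0"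
  shows "r * (radial \<theta> \<bullet> (vgrad S u (r *\<^sub>R radial \<theta>) *v angular \<theta>)) = - (u (r *\<^sub>R radial \<theta>) \<bullet> angular \<theta>)"
proof -
  let ?z = "r *\<^sub>R radial \<theta>" and ?g = "\<lambda>i. grad S (\<lambda>w. u w $ i) (r *\<^sub>R radial \<theta>)"
  have "((\<lambda>\<theta>. u (r *\<^sub>R radial \<theta>) $ i) has_real_derivative ?g i \<bullet> (r *\<^sub>R angular \<theta>)) (at \<theta>)" for i
    using assms(2) by (intro has_real_derivative_along_curve[where g="\<lambda>z. u z $ i"]
        C1_on_differentiable[OF assms(1)])
      (auto intro!: derivative_eq_intros has_vector_derivative_radial)
  note [derivative_intros] = this
  have "((\<lambda>\<theta>. u (r *\<^sub>R radial \<theta>) \<bullet> radial \<theta>) has_real_derivative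
      ((?g 1 \<bullet> (r *\<^sub>R angular \<theta>)) * cos \<theta> + (?g 2 \<bullet> (r *\<^sub>R angular \<theta>)) * sin \<theta> + u ?z \<bullet> angular \<theta>)) (at \<theta>)"
    unfolding inner_2[of "u _"] radial_nth angular_nth
    by (rule derivative_eq_intros refl)+ (simp add: algebra_simps)
  moreover have "((\<lambda>\<theta>. u (r *\<^sub>R radial \<theta>) \<bullet> radial \<theta>) has_real_derivative 0) (at \<theta>)"
    by (simp add: tangent)
  ultimately have "(?g 1 \<bullet> (r *\<^sub>R angular \<theta>)) * cos \<theta> + (?g 2 \<bullet> (r *\<^sub>R angular \<theta>)) * sin \<theta>
      + u ?z \<bullet> angular \<theta> = 0"
    by (rule DERIV_unique)
  then show ?thesis
    by (simp add: matrix_vector_mult_def vgrad_def grad_def inner_2 sum_2 algebra_simps)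
qed

text \<open>
The antisymmetric part of a \<open>2 \<times> 2\<close> matrix is the same in every positively oriented orthonormal basis.
\<close>

lemma rotated_gradient_difference_eq_curl:
  "angular \<theta> \<bullet> (vgrad S u z *v radial \<theta>) - radial \<theta> \<bullet> (vgrad S u z *v angular \<theta>) = curl2 S u z"
proof -
  have "angular \<theta> \<bullet> (vgrad S u z *v radial \<theta>) - radial \<theta> \<bullet> (vgrad S u z *v angular \<theta>)
      = cos \<theta> * cos \<theta> * curl2 S u z + sin \<theta> * sin \<theta> * curl2 S u z"
    by (simp add: matrix_vector_mult_def vgrad_def inner_2 sum_2 curl2_def algebra_simps)
  then show ?thesis
    by (simp flip: distrib_right)
qed

text \<open>
The pressure acts along the normal only, so the shear component sees just the symmetric part of the
velocity gradient.
\<close>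

lemma stress_shear_component:
  "(stress S \<nu> rs u P z *v radial \<theta>) \<bullet> angular \<theta>
    = \<nu> * (angular \<theta> \<bullet> (vgrad S u z *v radial \<theta>) + radial \<theta> \<bullet> (vgrad S u z *v angular \<theta>))"
  by (simp add: matrix_vector_mult_def stress_def mat_def transpose_def inner_2 sum_2 algebra_simps)

lemma orthogonal_to_radial:
  assumes "v \<bullet> radial \<theta> = 0"
  shows "v = (v \<bullet> angular \<theta>) *\<^sub>R angular \<theta>"
proof -
  have sc: "cos \<theta> * cos \<theta> + sin \<theta> * sin \<theta> = 1"
    by simp
  have v: "v $ 1 * cos \<theta> + v $ 2 * sin \<theta> = 0"
    using assms by (simp add: inner_2)
  have "v $ 1 = (v $ 1 * - sin \<theta> + v $ 2 * cos \<theta>) * - sin \<theta>"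
    "v $ 2 = (v $ 1 * - sin \<theta> + v $ 2 * cos \<theta>) * cos \<theta>"
    using v sc by algebra+
  then show ?thesis
    by (simp add: vec_eq_iff forall_2 inner_2)
qed

text \<open>
What is transported by \<open>u\<close> does not cross a circle to which \<open>u\<close> is tangent, and in the viscous part
\<open>u\<close> may be replaced by its angular component.
\<close>

lemma energy_flux_radial:
  assumes "u z \<bullet> radial \<theta> = 0"
  shows "energy_flux S \<nu> rs f u \<rho> P z \<bullet> radial \<theta>
    = \<nu> * (u z \<bullet> angular \<theta>) * (angular \<theta> \<bullet> (vgrad S u z *v radial \<theta>))"
proof -
  let ?q = "(1 / 2) * (u z $ 1 * u z $ 1 + u z $ 2 * u z $ 2) + (1 / rs) * (P z + \<rho> z * f z)"
  have "energy_flux S \<nu> rs f u \<rho> P z \<bullet> radial \<theta>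
      = \<nu> * (u z \<bullet> (vgrad S u z *v radial \<theta>)) - ?q * (u z \<bullet> radial \<theta>)"
    unfolding energy_flux_def matrix_vector_mult_def vgrad_def inner_2 sum_2 vec_lambda_beta
    by (simp add: algebra_simps)
  also have "u z \<bullet> (vgrad S u z *v radial \<theta>)
      = (u z \<bullet> angular \<theta>) * (angular \<theta> \<bullet> (vgrad S u z *v radial \<theta>))"
    using orthogonal_to_radial[OF assms] by (metis inner_scaleR_left)
  finally show ?thesis
    using assms by simp
qed

text \<open>
Without vorticity the two off-diagonal entries of the velocity gradient in the basis \<open>e\<^sub>r, e\<^sub>\<theta>\<close> agree,
and one of them is known from \<open>tangential_derivative_of_normal_component\<close>.
\<close>

lemma energy_flux_at_vorticity_free_wall:
  assumes "0 < r" "\<And>i. C1_on S (\<lambda>z. u z $ i)" "\<And>\<theta>. r *\<^sub>R radial \<theta> \<in> S"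
    and "\<And>\<theta>. u (r *\<^sub>R radial \<theta>) \<bullet> radial \<theta> = 0"
    and "curl2 S u (r *\<^sub>R radial \<theta>) = 0"
  shows "energy_flux S \<nu> rs f u \<rho> P (r *\<^sub>R radial \<theta>) \<bullet> radial \<theta>
    = - (\<nu> / r * (u (r *\<^sub>R radial \<theta>) \<bullet> angular \<theta>)\<^sup>2)"
proof -
  let ?w = "u (r *\<^sub>R radial \<theta>) \<bullet> angular \<theta>" and ?G = "vgrad S u (r *\<^sub>R radial \<theta>)"
  have "angular \<theta> \<bullet> (?G *v radial \<theta>) = radial \<theta> \<bullet> (?G *v angular \<theta>)"
    using rotated_gradient_difference_eq_curl[of \<theta> S u "r *\<^sub>R radial \<theta>"] assms(5) by simp
  moreover have "radial \<theta> \<bullet> (?G *v angular \<theta>) = - (?w / r)"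
    using tangential_derivative_of_normal_component[OF assms(2-4), of \<theta>] assms(1)
    by (simp add: field_simps)
  ultimately show ?thesis
    unfolding energy_flux_radial[where u = u, OF assms(4)] by (simp add: power2_eq_square)
qed

text \<open>
The slip condition prescribes the sum of the two off-diagonal entries of the velocity gradient. The normal
\<open>- e\<^sub>r\<close> is the outward one for a domain that lies outside the circle, and \<open>t\<close> stands for a tangent
vector of either orientation: \<open>t\<close> occurs in both terms of the condition, so it may be scaled freely.
\<close>

lemma energy_flux_at_slip_wall:
  assumes "0 < r" "\<And>i. C1_on S (\<lambda>z. u z $ i)" "\<And>\<theta>. r *\<^sub>R radial \<theta> \<in> S"
    and "\<And>\<theta>. u (r *\<^sub>R radial \<theta>) \<bullet> radial \<theta> = 0"
    and "t \<bullet> radial \<theta> = 0" "t \<noteq> 0"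
    and slip: "(stress S \<nu> rs u P (r *\<^sub>R radial \<theta>) *v (- radial \<theta>)) \<bullet> t + \<beta> * (u (r *\<^sub>R radial \<theta>) \<bullet> t) = 0"
  shows "energy_flux S \<nu> rs f u \<rho> P (r *\<^sub>R radial \<theta>) \<bullet> radial \<theta>
    = (\<nu> / r + \<beta>) * (u (r *\<^sub>R radial \<theta>) \<bullet> angular \<theta>)\<^sup>2"
proof -
  let ?w = "u (r *\<^sub>R radial \<theta>) \<bullet> angular \<theta>" and ?G = "vgrad S u (r *\<^sub>R radial \<theta>)"
  define k where "k = t \<bullet> angular \<theta>"
  have t: "t = k *\<^sub>R angular \<theta>"
    unfolding k_def by (rule orthogonal_to_radial[OF assms(5)])
  have "k * (- (\<nu> * (angular \<theta> \<bullet> (?G *v radial \<theta>) + radial \<theta> \<bullet> (?G *v angular \<theta>))) + \<beta> * ?w) = 0"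
    using slip unfolding t linear_neg[OF matrix_vector_mul_linear]
    by (simp add: stress_shear_component algebra_simps)
  moreover have "k \<noteq> 0"
    using t assms(6) by auto
  moreover have "radial \<theta> \<bullet> (?G *v angular \<theta>) = - (?w / r)"
    using tangential_derivative_of_normal_component[OF assms(2-4), of \<theta>] assms(1)
    by (simp add: field_simps)
  ultimately have "- (\<nu> * (angular \<theta> \<bullet> (?G *v radial \<theta>) - ?w / r)) + \<beta> * ?w = 0"
    by simp
  then have "\<nu> * (angular \<theta> \<bullet> (?G *v radial \<theta>)) = (\<nu> / r + \<beta>) * ?w"
    by (simp add: algebra_simps)
  then have "?w * (\<nu> * (angular \<theta> \<bullet> (?G *v radial \<theta>))) = (\<nu> / r + \<beta>) * ?w\<^sup>2"
    by (simp add: power2_eq_square)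
  then show ?thesis
    unfolding energy_flux_radial[where u = u, OF assms(4)] by (simp add: mult.assoc mult.left_commute)
qed

section \<open>Hydrostatic balance\<close>

text \<open>
The equation makes \<open>P\<close> twice continuously differentiable, since its first derivatives equal
differentiable functions. The mixed derivatives of \<open>P\<close> and of \<open>f\<close> are then symmetric, and subtracting
the two expressions for the mixed derivative of \<open>P\<close> leaves the Jacobian of \<open>\<rho>\<close> and \<open>f\<close>.
\<close>

lemma hydrostatic_density_if_gradient:
  assumes "open S" "C2_on S f" "C1_on S \<rho>" "C1_on S P"
    and balance: "\<And>z i. z \<in> S \<Longrightarrow> partial S i P z = 0 - \<rho> z * partial S i f z"
  shows "hydrostatic_density S f \<rho>"
  unfolding hydrostatic_density_def
proof (intro conjI ballI)
  fix z
  assume z: "z \<in> S"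
  have f: "C1_on S (partial S i f)" for i
    using assms(2) by (simp add: C2_on_def)
  have rhs: "C1_on S (\<lambda>z. 0 - \<rho> z * partial S i f z)" for i
    by (intro C1_on_diff C1_on_mult C1_on_const assms f)
  have "C1_on S (partial S i P)" for i
    by (rule C1_on_cong[OF assms(1) rhs[of i]]) (simp add: balance)
  then have "C2_on S P"
    using assms(4) by (simp add: C2_on_def)
  have "partial S j (partial S i P) z
      = 0 - (\<rho> z * partial S j (partial S i f) z + partial S j \<rho> z * partial S i f z)" for i j
  proof -
    have "partial S j (partial S i P) z = partial S j (\<lambda>z. 0 - \<rho> z * partial S i f z) z"
      by (rule partial_cong[OF assms(1) z differentiableI[OF C1_on_has_derivative[OF rhs assms(1) z]]])
        (simp add: balance)
    then show ?thesis
      by (simp only: partial_diff[OF assms(1)] partial_mult[OF assms(1)] partial_const[OF assms(1)]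
          C1_on_mult[OF assms(1)] C1_on_const[OF assms(1)] assms(3) f z)
  qed
  then show "partial S 2 \<rho> z * partial S 1 f z - partial S 1 \<rho> z * partial S 2 f z = 0"
    using mixed_partials_commute[OF \<open>C2_on S P\<close> assms(1) z, of 2 1]
      mixed_partials_commute[OF assms(2,1) z, of 2 1] by simp
qed (fact assms(3))

lemma hydrostatic_density_if_at_rest:
  assumes "open S" "C2_on S f" "C1_on S \<rho>" "C1_on S P" "0 < rs"
    and "stationary_boussinesq S \<nu> rs f u \<rho> P" "\<And>z. z \<in> S \<Longrightarrow> u z = 0"
  shows "hydrostatic_density S f \<rho>"
proof (rule hydrostatic_density_if_gradient[OF assms(1-4)])
  fix z i
  assume z: "z \<in> S"
  have first: "partial S j (\<lambda>w. u w $ k) w = 0" if "w \<in> S" for w j k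
    using partial_cong[OF assms(1) that, of "\<lambda>_. 0" "\<lambda>w. u w $ k" j]
      partial_const[OF assms(1) that, of j 0] assms(7) by simp
  have "partial S j (partial S j (\<lambda>w. u w $ k)) z = 0" for j k
    using partial_cong[OF assms(1) z, of "\<lambda>_. 0" "partial S j (\<lambda>w. u w $ k)" j]
      partial_const[OF assms(1) z, of j 0] first by simp
  then have "vlaplacian S u z = 0"
    by (simp add: vlaplacian_def laplacian_def vec_eq_iff)
  moreover have "convective S u z = 0"
    unfolding convective_def assms(7)[OF z] by (simp add: vec_eq_iff)
  moreover have "convective S u z $ i
      = (\<nu> *\<^sub>R vlaplacian S u z - (1 / rs) *\<^sub>R grad S P z - (\<rho> z / rs) *\<^sub>R grad S f z) $ i"
    using assms(6) z by (simp add: stationary_boussinesq_def)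
  ultimately show "partial S i P z = 0 - \<rho> z * partial S i f z"
    using assms(5) by (simp add: grad_def field_simps)
qed

theorem lemma1p1:
  fixes a b \<nu> rs :: real
    and \<alpha> f \<rho> P :: "real^2 \<Rightarrow> real"
    and u \<tau> :: "real^2 \<Rightarrow> real^2"
  assumes "0 < a" and "a < b" and "0 < \<nu>" and "0 < rs"
    and "C2_on (annulus a b) f" and "continuous_on (closure (annulus a b)) f"
    and "unit_tangent_field a b \<tau>"
    and "classical_regularity a b u \<rho> P"
    and "stationary_boussinesq (annulus a b) \<nu> rs f u \<rho> P"
    and "boundary_conditions a b \<nu> rs \<alpha> \<tau> u P"
    and "\<forall>z \<in> circle a. \<nu> * inverse a + \<alpha> z \<ge> 0"
  shows "(\<forall>z \<in> closure (annulus a b). u z = 0) \<and>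
         (\<exists>\<rho>s. (\<forall>z \<in> closure (annulus a b). \<rho> z = \<rho>s z) \<and>
               hydrostatic_density (annulus a b) f \<rho>s)"
proof -
  let ?S = "annulus a b" and ?cl = "closure (annulus a b)"
  note S = open_annulus[of a b]
  have C2u: "C2_on ?S (\<lambda>z. u z $ i)" and C1u: "C1_on ?cl (\<lambda>z. u z $ i)" for i
    using assms(8) by (auto simp: classical_regularity_def)
  have C1: "C1_on ?S f" "C1_on ?S \<rho>" "C1_on ?S P"
    and cont: "continuous_on ?cl \<rho>" "continuous_on ?cl P"
    using assms(5,8) by (auto simp: classical_regularity_def C2_on_def)
  \<comment> \<open>With derivatives taken within the closed annulus, the field has values on the walls and is
    continuous there; inside it agrees with the one built from ordinary derivatives.\<close>
  define F where "F = energy_flux ?cl \<nu> rs f u \<rho> P"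
  have F_eq: "energy_flux ?S \<nu> rs f u \<rho> P z $ j = F z $ j" if "z \<in> ?S" for z j
    unfolding F_def energy_flux_def using partial_subset[OF S closure_subset that] by simp
  have C1F: "C1_on ?S (\<lambda>z. F z $ j)" for j
    by (rule C1_on_cong[OF S C1_on_energy_flux[OF S C2u C1, of \<nu> rs j] F_eq])
  let ?D = "\<lambda>z. \<nu> * (\<Sum>i\<in>UNIV. \<Sum>j\<in>UNIV. (partial ?S j (\<lambda>w. u w $ i) z)\<^sup>2)"
  have divF: "divergence ?S F z = ?D z" if z: "z \<in> ?S" for z
  proof -
    have "partial ?S j (\<lambda>z. F z $ j) z = partial ?S j (\<lambda>z. energy_flux ?S \<nu> rs f u \<rho> P z $ j) z" for j
      using C1_on_has_derivative[OF C1_on_energy_flux[OF S C2u C1, of \<nu> rs j] S z] F_eq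
      by (intro partial_cong[OF S z]) (auto intro: differentiableI)
    then show ?thesis
      using divergence_energy_flux[OF S C2u C1 assms(9) z] by (simp add: divergence_def)
  qed
  have wall: "a *\<^sub>R radial \<theta> \<in> ?cl" "b *\<^sub>R radial \<theta> \<in> ?cl" for \<theta>
    using assms(1,2) by (auto intro!: polar_in_closure_annulus)
  have n: "outward_normal a b (a *\<^sub>R radial \<theta>) = - radial \<theta>"
    "outward_normal a b (b *\<^sub>R radial \<theta>) = radial \<theta>" for \<theta>
  proof -
    have "b *\<^sub>R radial \<theta> \<notin> circle a"
      using assms(1,2) by (simp add: circle_def polar_sq)
    then show "outward_normal a b (a *\<^sub>R radial \<theta>) = - radial \<theta>"
      "outward_normal a b (b *\<^sub>R radial \<theta>) = radial \<theta>"
      using polar_in_circle[of a \<theta>] assms(1,2) by (simp_all add: outward_normal_def)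
  qed
  have "u (a *\<^sub>R radial \<theta>) \<bullet> outward_normal a b (a *\<^sub>R radial \<theta>) = 0"
    "u (b *\<^sub>R radial \<theta>) \<bullet> outward_normal a b (b *\<^sub>R radial \<theta>) = 0" for \<theta>
    using assms(10) polar_in_circle by (auto simp: boundary_conditions_def)
  then have tangent: "u (a *\<^sub>R radial \<theta>) \<bullet> radial \<theta> = 0" "u (b *\<^sub>R radial \<theta>) \<bullet> radial \<theta> = 0" for \<theta>
    by (simp_all add: n)
  have inner: "0 \<le> F (a *\<^sub>R radial \<theta>) \<bullet> radial \<theta>" for \<theta>
  proof -
    let ?z = "a *\<^sub>R radial \<theta>"
    have z: "?z \<in> circle a"
      by (rule polar_in_circle)
    have "norm (\<tau> ?z) = 1" "\<tau> ?z \<bullet> outward_normal a b ?z = 0"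
      using assms(7) z unfolding unit_tangent_field_def by blast+
    then have "\<tau> ?z \<bullet> radial \<theta> = 0" "\<tau> ?z \<noteq> 0"
      by (auto simp: n)
    moreover have "(stress ?cl \<nu> rs u P ?z *v (- radial \<theta>)) \<bullet> \<tau> ?z + \<alpha> ?z * (u ?z \<bullet> \<tau> ?z) = 0"
      using assms(10) z unfolding boundary_conditions_def n(1)[symmetric] by blast
    ultimately have "F ?z \<bullet> radial \<theta> = (\<nu> / a + \<alpha> ?z) * (u ?z \<bullet> angular \<theta>)\<^sup>2"
      unfolding F_def by (rule energy_flux_at_slip_wall[OF assms(1) C1u wall(1) tangent(1)])
    moreover have "0 \<le> \<nu> / a + \<alpha> ?z"
      using assms(11) z by (simp add: divide_inverse)
    ultimately show ?thesis
      by simp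
  qed
  have outer: "F (b *\<^sub>R radial \<theta>) \<bullet> radial \<theta> \<le> 0" for \<theta>
  proof -
    have "curl2 ?cl u (b *\<^sub>R radial \<theta>) = 0"
      using assms(10) polar_in_circle by (auto simp: boundary_conditions_def)
    moreover have "0 < b"
      using assms(1,2) by simp
    ultimately show ?thesis
      unfolding F_def using assms(3)
      by (simp add: energy_flux_at_vorticity_free_wall[OF _ C1u wall(2) tangent(2)])
  qed
  have "continuous_on ?S (partial ?S j (\<lambda>w. u w $ i))" for i j
    using C2u by (simp add: C2_on_def C1_on_def)
  then have "continuous_on ?S ?D"
    by (intro continuous_intros)
  then have contdiv: "continuous_on ?S (divergence ?S F)"
    using divF by (metis (no_types, lifting) continuous_on_cong)
  have contF: "continuous_on ?cl F"
    unfolding F_def by (intro continuous_on_energy_flux C1u assms(6) cont)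
  have nonneg: "0 \<le> divergence ?S F z" if "z \<in> ?S" for z
    using that assms(3) by (simp add: divF sum_nonneg)
  have "?D z = 0" if "z \<in> ?S" for z
    using divergence_eq_0_if_no_outflow[OF _ assms(2) contF C1F contdiv nonneg inner outer that]
      divF[OF that] assms(1) by simp
  then have "(\<Sum>i\<in>UNIV. \<Sum>j\<in>UNIV. (partial ?S j (\<lambda>w. u w $ i) z)\<^sup>2) = 0" if "z \<in> ?S" for z
    using assms(3) that by (metis less_irrefl mult_eq_0_iff)
  then have partial0: "partial ?S j (\<lambda>w. u w $ i) z = 0" if "z \<in> ?S" for z i j
    using that by (simp add: sum_nonneg_eq_0_iff sum_nonneg)
  have const: "(\<lambda>z. u z $ i) constant_on ?S" for i
  proof (rule has_derivative_zero_connected_constant_on[where K = "{}"])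
    show "connected ?S"
      using assms(1,2) by (intro connected_annulus_2) auto
    have C1i: "C1_on ?S (\<lambda>z. u z $ i)"
      using C2u by (simp add: C2_on_def)
    then show "continuous_on ?S (\<lambda>z. u z $ i)"
      by (rule C1_on_continuous)
    have "((\<lambda>z. u z $ i) has_derivative (\<lambda>h. 0)) (at z within ?S)" if "z \<in> ?S" for z
    proof -
      have "grad ?S (\<lambda>z. u z $ i) z = 0"
        using partial0[OF that] by (simp add: grad_def vec_eq_iff)
      then show ?thesis
        using has_derivative_grad[OF C1_on_differentiable[OF C1i that]] by simp
    qed
    then show "\<forall>z\<in>?S - {}. ((\<lambda>z. u z $ i) has_derivative (\<lambda>h. 0)) (at z within ?S)"
      by blast
  qed (use S in auto)
  obtain C where C: "\<And>z i. z \<in> ?S \<Longrightarrow> u z $ i = C i"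
    using const unfolding constant_on_def by metis
  have Ccl: "u z $ i = C i" if "z \<in> ?cl" for z i
    by (rule continuous_constant_on_closure[OF C1_on_continuous[OF C1u] C that])
  \<comment> \<open>The constant velocity is tangent to the outer circle at each of its points.\<close>
  have "C 1 * cos \<theta> + C 2 * sin \<theta> = 0" for \<theta>
    using tangent(2)[of \<theta>] Ccl[OF wall(2)] by (simp add: inner_2)
  from this[of 0] this[of "pi / 2"] have "C i = 0" for i
    using exhaust_2[of i] by auto
  then have rest: "u z = 0" if "z \<in> ?cl" for z
    using Ccl[OF that] by (simp add: vec_eq_iff)
  moreover have "hydrostatic_density ?S f \<rho>"
    using rest closure_subset[of ?S]
    by (intro hydrostatic_density_if_at_rest[OF S assms(5) C1(2,3) assms(4,9)]) auto
  ultimately show ?thesis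
    by blast
qed

end
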